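(* Let $n \ge 1$ and let $W$ be the number of fixed points of a uniformly random permutation $\sigma$ of $\{1,\ldots,n\}$, i.e. $W = |\{i : \sigma(i) = i\}|$. Then $$\|\mathcal{L}(W) - \mathrm{Poi}_1\|_{TV} \leq \frac{2}{n}.$$
   Context: $\mathcal{L}(W)$ denotes the law of $W$ and $\mathrm{Poi}_1$ the Poisson distribution with mean $1$ on $\{0,1,2,\ldots\}$. The total variation distance is $\|\mu-\nu\|_{TV} = \sup_A |\mu(A)-\nu(A)|$, the supremum being over all measurable sets $A$. *)

theory Defs
  imports "HOL-Probability.Probability" "HOL-Combinatorics.Permutations"
begin

(* Intended for probability measures M, N with the same measurable sets. The supremum is
   taken in the reals; it is over a nonempty set bounded by 1, hence the true supremum
   (see tv_dist_upper). *)
definition tv_dist :: "'a measure \<Rightarrow> 'a measure \<Rightarrow> real" where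
  "tv_dist M N = (SUP A\<in>sets M. \<bar>measure M A - measure N A\<bar>)"

lemma tv_dist_upper:
  assumes "prob_space M" "prob_space N" "A \<in> sets M"
  shows "\<bar>measure M A - measure N A\<bar> \<le> tv_dist M N"
  unfolding tv_dist_def
proof (rule cSUP_upper[OF assms(3)], rule bdd_aboveI2)
  fix B
  show "\<bar>measure M B - measure N B\<bar> \<le> 1"
    using prob_space.prob_le_1[OF assms(1), of B] prob_space.prob_le_1[OF assms(2), of B]
      measure_nonneg[of M B] measure_nonneg[of N B] by linarith
qed

definition num_fixed_points :: "nat \<Rightarrow> (nat \<Rightarrow> nat) \<Rightarrow> nat" where
  "num_fixed_points n \<sigma> = card {i \<in> {1..n}. \<sigma> i = i}"

definition fixed_points_law :: "nat \<Rightarrow> nat pmf" where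
  "fixed_points_law n = map_pmf (num_fixed_points n) (pmf_of_set {\<sigma>. \<sigma> permutes {1..n}})"

end

theory Submission
  imports Defs
begin

text \<open>
  Sorting the permutations by their set of fixed points gives
  \<open>P(W = k) = d (n - k) / k!\<close>, where \<open>d m\<close> is the proportion of derangements among the
  permutations of \<open>m\<close> points, that is, the \<open>m\<close>-th partial sum of the series of \<open>exp (-1)\<close>.
  The remainder of that series is at most \<open>1 / (m + 1)!\<close>, so the total variation distance is at
  most \<open>\<Sum>k\<le>n. 1 / (k! (n + 1 - k)!) \<le> 2 ^ (n + 1) / (n + 1)!\<close>. This is at most \<open>2 / n\<close> for
  \<open>n \<ge> 3\<close>, and for \<open>n \<le> 2\<close> the claim is trivial.
\<close>

lemma sum_Pow_card:
  fixes f :: "nat \<Rightarrow> real"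
  assumes "finite S"
  shows "(\<Sum>U\<in>Pow S. f (card U)) = (\<Sum>m\<le>card S. real (card S choose m) * f m)"
proof -
  have "(\<Sum>U\<in>Pow S. f (card U))
      = (\<Sum>m\<le>card S. \<Sum>U\<in>{U \<in> Pow S. card U = m}. f (card U))"
    by (rule sum.group[symmetric]) (use assms in \<open>auto intro: card_mono\<close>)
  also have "\<dots> = (\<Sum>m\<le>card S. real (card S choose m) * f m)"
    using n_subsets[OF assms] by (intro sum.cong) (auto simp: Pow_def)
  finally show ?thesis .
qed

definition derangements :: "'a set \<Rightarrow> ('a \<Rightarrow> 'a) set" where
  "derangements S = {p. p permutes S \<and> (\<forall>i\<in>S. p i \<noteq> i)}"

text \<open>A permutation of \<open>S\<close> that fixes \<open>T\<close> pointwise is the identity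
  off \<open>S - T\<close>, so it permutes \<open>S - T\<close>. Conversely, a derangement of
  \<open>S - T\<close> is the identity on \<open>T\<close>, which lies in \<open>S\<close>.\<close>

lemma permutes_fixing_exactly:
  assumes "T \<subseteq> S"
  shows "{p. p permutes S \<and> {i \<in> S. p i = i} = T} = derangements (S - T)"
proof -
  have "p permutes S - T" if "p permutes S" "{i \<in> S. p i = i} = T" for p
    using that by (auto intro: permutes_superset[OF that(1)])
  moreover have "p permutes S" if "p permutes S - T" for p
    using that by (rule permutes_subset) auto
  ultimately show ?thesis
    using assms by (auto simp: derangements_def permutes_not_in)
qed

text \<open>\<open>P\<close> stays general for two uses: the always true predicate gives a recursion
  for the derangement numbers, and \<open>card T = k\<close> gives the law of the fixed point
  count.\<close>

lemma card_permutes_sum_derangements: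
  assumes "finite S"
  shows "card {p. p permutes S \<and> P {i \<in> S. p i = i}}
       = (\<Sum>T | T \<subseteq> S \<and> P T. card (derangements (S - T)))"
proof -
  let ?A = "\<lambda>T. {p. p permutes S \<and> {i \<in> S. p i = i} = T}"
  have "{p. p permutes S \<and> P {i \<in> S. p i = i}} = (\<Union>T\<in>{T. T \<subseteq> S \<and> P T}. ?A T)"
    by auto
  also have "card \<dots> = (\<Sum>T | T \<subseteq> S \<and> P T. card (?A T))"
    using assms finite_permutations[OF assms] by (intro card_UN_disjoint) auto
  also have "\<dots> = (\<Sum>T | T \<subseteq> S \<and> P T. card (derangements (S - T)))"
    by (intro sum.cong refl) (simp add: permutes_fixing_exactly)
  finally show ?thesis .
qed

definition derangement_ratio :: "nat \<Rightarrow> real" where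
  "derangement_ratio m = (\<Sum>j\<le>m. (-1) ^ j / fact j)"

text \<open>Taking partial sums is multiplication by 1/(1-x), so the ratios have generating function
  exp(-x)/(1-x). Multiplying by exp(x) leaves 1/(1-x), all of whose coefficients are 1.\<close>

lemma derangement_ratio_convolution:
  "(\<Sum>m\<le>n. derangement_ratio m / fact (n - m)) = 1"
proof -
  let ?one = "Abs_fps (\<lambda>_. 1 :: real)"
  have "Abs_fps derangement_ratio = fps_exp (-1) * ?one"
    by (rule fps_ext) (simp add: fps_mult_nth derangement_ratio_def atMost_atLeast0)
  then have "Abs_fps derangement_ratio * fps_exp 1 = ?one * (fps_exp (-1) * fps_exp 1)"
    by (simp add: mult_ac)
  also have "fps_exp (-1) * fps_exp 1 = (1 :: real fps)"
    by (simp flip: fps_exp_add_mult)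
  finally have "fps_nth (Abs_fps derangement_ratio * fps_exp 1) n = fps_nth ?one n"
    by simp
  then show ?thesis
    by (simp add: fps_mult_nth atMost_atLeast0)
qed

text \<open>Both sides, summed over all subsets of \<open>S\<close>, give
  \<open>fact (card S)\<close>. By induction they agree on proper subsets, hence also on
  \<open>S\<close> itself.\<close>

lemma card_derangements:
  assumes "finite S"
  shows "real (card (derangements S)) = fact (card S) * derangement_ratio (card S)"
  using assms
proof (induction S rule: finite_psubset_induct)
  case (psubset S)
  let ?n = "card S"
  let ?f = "\<lambda>m. fact m * derangement_ratio m"
  have "fact ?n = real (card {p. p permutes S})"
    using card_permutations[OF refl psubset.hyps] by simp
  also have "\<dots> = (\<Sum>T\<in>Pow S. real (card (derangements (S - T))))"
    using card_permutes_sum_derangements[OF psubset.hyps, of "\<lambda>_. True"]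
    by (simp add: Pow_def)
  also have "\<dots> = (\<Sum>U\<in>Pow S. real (card (derangements U)))"
    by (rule sum.reindex_bij_witness[of _ "\<lambda>U. S - U" "\<lambda>U. S - U"])
       (auto simp: double_diff)
  also have "\<dots> = real (card (derangements S)) + (\<Sum>U\<in>Pow S - {S}. ?f (card U))"
    using psubset by (subst sum.remove[of _ S]) (auto intro!: sum.cong)
  finally have 1: "fact ?n = real (card (derangements S)) + (\<Sum>U\<in>Pow S - {S}. ?f (card U))" .
  \<comment> \<open>The closed form satisfies the same recursion as fact \<open>1\<close>, by the
    convolution identity; the sums over proper subsets then cancel.\<close>
  have "?f ?n + (\<Sum>U\<in>Pow S - {S}. ?f (card U)) = (\<Sum>U\<in>Pow S. ?f (card U))"
    using psubset.hyps by (subst (2) sum.remove[of _ S]) auto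
  also have "\<dots> = (\<Sum>m\<le>?n. real (?n choose m) * ?f m)"
    by (rule sum_Pow_card[OF psubset.hyps])
  also have "\<dots> = fact ?n * (\<Sum>m\<le>?n. derangement_ratio m / fact (?n - m))"
    unfolding sum_distrib_left by (intro sum.cong) (auto simp: binomial_fact)
  finally show ?case
    using 1 by (simp add: derangement_ratio_convolution)
qed

lemma pmf_fixed_points_law:
  "pmf (fixed_points_law n) k
     = (if k \<le> n then derangement_ratio (n - k) / fact k else 0)"
proof -
  let ?S = "{1..n}"
  let ?T = "{T. T \<subseteq> ?S \<and> card T = k}"
  let ?P = "{\<sigma>. \<sigma> permutes ?S}"
  have fin: "finite ?P"
    by (simp add: finite_permutations)
  have ne: "?P \<noteq> {}"
    using permutes_id by blast
  have "pmf (fixed_points_law n) k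
      = real (card (?P \<inter> num_fixed_points n -` {k})) / real (card ?P)"
    unfolding fixed_points_law_def pmf_map using fin ne by (simp add: measure_pmf_of_set)
  also have "card ?P = fact n"
    by (simp add: card_permutations)
  also have "?P \<inter> num_fixed_points n -` {k}
      = {p. p permutes ?S \<and> card {i \<in> ?S. p i = i} = k}"
    by (auto simp: num_fixed_points_def)
  also have "card \<dots> = (\<Sum>T\<in>?T. card (derangements (?S - T)))"
    by (rule card_permutes_sum_derangements) simp
  also have "real \<dots> = (\<Sum>T\<in>?T. fact (n - k) * derangement_ratio (n - k))"
    by (auto simp: card_derangements card_Diff_subset finite_subset[of _ ?S] intro!: sum.cong)
  \<comment> \<open>For \<open>k > n\<close> the binomial coefficient is 0, so the truncated
    \<open>n - k\<close> does no harm.\<close>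
  also have "\<dots> = real (n choose k) * (fact (n - k) * derangement_ratio (n - k))"
    using n_subsets[of ?S k] by simp
  finally show ?thesis
    by (auto simp: binomial_fact)
qed

lemma derangement_ratio_approx:
  "\<bar>derangement_ratio m - exp (-1)\<bar> \<le> 1 / fact (Suc m)"
proof -
  \<comment> \<open>Lagrange remainder of exp at -1: the intermediate point is negative, so
    \<open>exp t\<close> is below 1.\<close>
  obtain t :: real where t: "t < 0"
    and eq: "exp (-1) = (\<Sum>j<Suc m. exp 0 / fact j * (-1) ^ j)
               + exp t / fact (Suc m) * (-1) ^ Suc m"
    using Maclaurin_minus[of "-1" "Suc m" "\<lambda>_. exp" exp] by auto
  have "derangement_ratio m = (\<Sum>j<Suc m. exp 0 / fact j * (-1) ^ j)"
    by (simp add: derangement_ratio_def lessThan_Suc_atMost)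
  then have "\<bar>derangement_ratio m - exp (-1)\<bar> = exp t / fact (Suc m)"
    unfolding eq by (simp add: abs_mult power_abs del: fact_Suc)
  also have "\<dots> \<le> 1 / fact (Suc m)"
    using t by (intro divide_right_mono) auto
  finally show ?thesis .
qed

text \<open>Only the mass on a support of one of the measures matters, because the total masses agree:
  one of \<open>A\<close> and its complement has nonnegative excess.\<close>
lemma tv_dist_pmf_le_sum:
  fixes p q :: "'a pmf"
  assumes "finite F" "set_pmf p \<subseteq> F"
  shows "tv_dist (measure_pmf p) (measure_pmf q) \<le> (\<Sum>x\<in>F. \<bar>pmf p x - pmf q x\<bar>)"
proof -
  have *: "measure_pmf.prob p A - measure_pmf.prob q A \<le> (\<Sum>x\<in>F. \<bar>pmf p x - pmf q x\<bar>)" for A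
  proof -
    \<comment> \<open>Cutting \<open>A\<close> down to \<open>F\<close> keeps the mass under
      \<open>p\<close> and can only lower the mass under \<open>q\<close>, so the difference does
      not decrease.\<close>
    have "measure_pmf.prob p A = measure_pmf.prob p (A \<inter> F)"
      using assms(2) by (intro measure_pmf.finite_measure_eq_AE) (auto simp: AE_measure_pmf_iff)
    moreover have "measure_pmf.prob q (A \<inter> F) \<le> measure_pmf.prob q A"
      by (intro measure_pmf.finite_measure_mono) auto
    ultimately have "measure_pmf.prob p A - measure_pmf.prob q A
        \<le> (\<Sum>x\<in>A \<inter> F. pmf p x - pmf q x)"
      using assms(1) by (simp add: measure_measure_pmf_finite sum_subtractf)
    also have "\<dots> \<le> (\<Sum>x\<in>A \<inter> F. \<bar>pmf p x - pmf q x\<bar>)"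
      by (intro sum_mono) auto
    also have "\<dots> \<le> (\<Sum>x\<in>F. \<bar>pmf p x - pmf q x\<bar>)"
      using assms(1) by (intro sum_mono2) auto
    finally show ?thesis .
  qed
  have "\<bar>measure_pmf.prob p A - measure_pmf.prob q A\<bar> \<le> (\<Sum>x\<in>F. \<bar>pmf p x - pmf q x\<bar>)" for A
    using *[of A] *[of "- A"] measure_pmf.prob_compl[of A p] measure_pmf.prob_compl[of A q]
    by (simp add: Compl_eq_Diff_UNIV)
  then show ?thesis
    unfolding tv_dist_def by (intro cSUP_least) auto
qed

lemma tv_dist_pmf_le_1:
  fixes p q :: "'a pmf"
  shows "tv_dist (measure_pmf p) (measure_pmf q) \<le> 1"
  unfolding tv_dist_def
proof (rule cSUP_least)
  fix A
  show "\<bar>measure_pmf.prob p A - measure_pmf.prob q A\<bar> \<le> 1"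
    using measure_pmf.prob_le_1[of p A] measure_pmf.prob_le_1[of q A]
      measure_nonneg[of p A] measure_nonneg[of q A] by linarith
qed auto

text \<open>Equality holds at 3 (both sides are 48), while 2 fails with 16 against 12; hence the
  starting point.\<close>

lemma power2_times_le_fact: "3 \<le> n \<Longrightarrow> 2 ^ Suc n * n \<le> 2 * (fact (Suc n) :: nat)"
proof (induction n rule: nat_induct_at_least)
  case base
  show ?case by (simp add: fact_numeral eval_nat_numeral)
next
  case (Suc n)
  \<comment> \<open>The extra factor \<open>n\<close>, cancelled at the end, exposes the induction
    hypothesis. What remains is 2(n+1) \<le> n(n+2), that is, n^2 \<ge> 2.\<close>
  have "n * (2 ^ Suc (Suc n) * Suc n) = 2 * Suc n * (2 ^ Suc n * n)"
    by (simp add: algebra_simps)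
  also have "\<dots> \<le> 2 * Suc n * (2 * fact (Suc n))"
    using Suc.IH by (rule mult_le_mono2)
  also have "\<dots> \<le> (n * Suc (Suc n)) * (2 * fact (Suc n))"
    using mult_le_mono[OF Suc.hyps Suc.hyps] by (intro mult_le_mono1) simp
  also have "\<dots> = n * (2 * fact (Suc (Suc n)))"
    by (simp add: fact_Suc[of "Suc n"] algebra_simps del: fact_Suc)
  finally show ?case
    using Suc.hyps by (simp del: fact_Suc power_Suc)
qed

lemma tv_dist_fixed_points_poisson:
  "tv_dist (measure_pmf (fixed_points_law n)) (measure_pmf (poisson_pmf 1))
     \<le> 2 ^ Suc n / fact (Suc n)"
proof -
  have "set_pmf (fixed_points_law n) \<subseteq> {..n}"
    by (auto simp: set_pmf_eq pmf_fixed_points_law split: if_splits)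
  then have "tv_dist (measure_pmf (fixed_points_law n)) (measure_pmf (poisson_pmf 1))
      \<le> (\<Sum>k\<le>n. \<bar>pmf (fixed_points_law n) k - pmf (poisson_pmf 1) k\<bar>)"
    by (intro tv_dist_pmf_le_sum) auto
  also have "\<dots> \<le> (\<Sum>k\<le>n. real (Suc n choose k) / fact (Suc n))"
  proof (rule sum_mono)
    fix k assume "k \<in> {..n}"
    then have k: "k \<le> n" by simp
    have "\<bar>pmf (fixed_points_law n) k - pmf (poisson_pmf 1) k\<bar>
        = \<bar>derangement_ratio (n - k) - exp (-1)\<bar> / fact k"
      using k by (simp add: pmf_fixed_points_law flip: diff_divide_distrib)
    also have "\<dots> \<le> 1 / fact (Suc (n - k)) / fact k"
      by (intro divide_right_mono derangement_ratio_approx) auto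
    also have "\<dots> = real (Suc n choose k) / fact (Suc n)"
      using k by (simp add: binomial_fact Suc_diff_le del: fact_Suc)
    finally show "\<bar>pmf (fixed_points_law n) k - pmf (poisson_pmf 1) k\<bar>
        \<le> real (Suc n choose k) / fact (Suc n)" .
  qed
  \<comment> \<open>Adding the term at \<open>Suc n\<close> completes a full binomial row, whose sum
    is a power of 2.\<close>
  also have "\<dots> \<le> (\<Sum>k\<le>Suc n. real (Suc n choose k) / fact (Suc n))"
    by (intro sum_mono2) auto
  also have "\<dots> = 2 ^ Suc n / fact (Suc n)"
    using arg_cong[OF choose_row_sum[of "Suc n"], of real]
    by (simp only: of_nat_sum of_nat_power of_nat_numeral flip: sum_divide_distrib)
  finally show ?thesis .
qed

theorem theorem5:
  fixes n :: nat
  assumes "n \<ge> 1"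
  shows "tv_dist (measure_pmf (fixed_points_law n)) (measure_pmf (poisson_pmf 1)) \<le> 2 / real n"
proof (cases "n \<le> 2")
  case True
  then have "1 \<le> 2 / real n"
    using assms by (simp add: field_simps)
  with tv_dist_pmf_le_1 show ?thesis
    by (rule order_trans)
next
  case False
  then have "real (2 ^ Suc n * n) \<le> real (2 * fact (Suc n))"
    using power2_times_le_fact[of n] by (subst of_nat_le_iff) simp
  then have "2 ^ Suc n / fact (Suc n) \<le> 2 / real n"
    using assms by (simp add: divide_simps del: fact_Suc power_Suc)
  with tv_dist_fixed_points_poisson show ?thesis
    by (rule order_trans)
qed

end
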